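(* Let $G$ be a monoid and let $X$ be a $G$-act such that $|G|\le\psi(x_0,\zeta_G)$ for some point $x_0\in X$. Then, for every infinite cardinal $\kappa$ satisfying $|G|\le\kappa\le\psi(x_0,\zeta_G)$ and every infinite cardinal $\lambda\le\mathrm{cf}(\kappa)$, the $G$-act $X$ admits $2^{2^\kappa}$ hereditarily normal $G$-topologies with pseudocharacter $\lambda$ at the point $x_0$.
   Context: Let $G$ be a monoid with two-sided unit $1_G$. A $G$-act is a set $X$ together with a map $G\times X\to X$, $(g,x)\mapsto g(x)$, such that $f(g(x))=(fg)(x)$ for all $f,g\in G$, $x\in X$, and $1_G(x)=x$ for all $x\in X$. A topology on $X$ is a $G$-topology if for every $g\in G$ the map $x\mapsto g(x)$ from $X$ to $X$ is continuous. The Zariski $G$-topology $\zeta_G$ on $X$ is the topology generated by the subbase consisting of all sets $\{x\in X: f(x)\ne g(x)\}$ and $\{x\in X: f(x)\ne c\}$, where $f,g\in G$ and $c\in X$; it is a $T_1$ topology. For a topology $\tau$ on $X$ and $x\in X$, let $\tau_x=\{U\in\tau:x\in U\}$. The pseudocharacter of $\tau$ at $x$ is $\psi(x,\tau)=\min\{|\mathcal U|:\mathcal U\subset\tau_x,\ \bigcap\mathcal U=\bigcap\tau_x\}$ (for $T_1$ topologies, $\bigcap\tau_x=\{x\}$). A topology is normal if it is $T_1$ and any two disjoint closed sets have disjoint open neighborhoods; it is hereditarily normal if every subspace is normal. $\mathrm{cf}(\kappa)$ denotes the cofinality of $\kappa$. "$X$ admits $N$ topologies with a property" means that there is a family of cardinality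 $N$ of pairwise distinct topologies on $X$ with this property. *)

theory Defs
  imports "HOL-Algebra.Group" "HOL-Analysis.Abstract_Topological_Spaces"
begin

unbundle cardinal_syntax

text \<open>Cardinals are cardinal orders, as in the library, so \<open>=o\<close> and \<open>\<le>o\<close> express equality and
  comparison of cardinals. The minimum of the cardinalities of the members of \<open>\<F>\<close> is thus
  determined only up to \<open>=o\<close>; it is meaningful only for \<open>\<F> \<noteq> {}\<close>.\<close>

definition least_card :: "'a set set \<Rightarrow> 'a rel" where
  "least_card \<F> = |SOME A. A \<in> \<F> \<and> (\<forall>B\<in>\<F>. |A| \<le>o |B| )|"

lemma least_card_exists:
  assumes "\<F> \<noteq> {}"
  shows "\<exists>A\<in>\<F>. \<forall>B\<in>\<F>. |A| \<le>o |B|"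
  using exists_minim_Card_order[of "card_of ` \<F>"] assms by (auto simp: card_of_Card_order)

lemma least_card_attained:
  assumes "\<F> \<noteq> {}"
  shows "\<exists>A\<in>\<F>. least_card \<F> = |A|"
proof -
  have "\<exists>A. A \<in> \<F> \<and> (\<forall>B\<in>\<F>. |A| \<le>o |B| )"
    using least_card_exists[OF assms] by blast
  from someI_ex[OF this] show ?thesis unfolding least_card_def by blast
qed

lemma least_card_le:
  assumes "B \<in> \<F>"
  shows "least_card \<F> \<le>o |B|"
proof -
  have "\<exists>A. A \<in> \<F> \<and> (\<forall>B\<in>\<F>. |A| \<le>o |B| )"
    using least_card_exists[of \<F>] assms by blast
  from someI_ex[OF this] assms show ?thesis unfolding least_card_def by blast
qed

text \<open>The library's \<open>cofinal\<close> asks for strict upper bounds. For infinite cardinals, which have no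
  largest element, this is the usual notion; \<open>cf\<close> is only meant for these.\<close>

definition cf :: "'a rel \<Rightarrow> 'a rel" where
  "cf r = least_card {A. A \<subseteq> Field r \<and> cofinal A r}"

lemma cofinal_Field:
  assumes "Cinfinite r"
  shows "cofinal (Field r) r"
  unfolding cofinal_def
proof
  fix a assume "a \<in> Field r"
  with assms show "\<exists>b\<in>Field r. a \<noteq> b \<and> (a, b) \<in> r"
    unfolding cinfinite_def by (intro infinite_Card_order_limit) simp_all
qed

text \<open>The only ambient-type effect here is that \<open>\<Inter>{} = UNIV\<close>; it can only turn the value \<open>1\<close>
  into \<open>0\<close>.\<close>

definition pseudocharacter :: "'a topology \<Rightarrow> 'a \<Rightarrow> 'a set rel" where
  "pseudocharacter \<tau> x =
     least_card {\<U>. \<U> \<subseteq> {U. openin \<tau> U \<and> x \<in> U} \<and> \<Inter>\<U> = \<Inter>{U. openin \<tau> U \<and> x \<in> U}}"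

lemma pseudocharacter_attained:
  "\<exists>\<U>. \<U> \<subseteq> {U. openin \<tau> U \<and> x \<in> U} \<and> \<Inter>\<U> = \<Inter>{U. openin \<tau> U \<and> x \<in> U}
       \<and> pseudocharacter \<tau> x = |\<U>|"
  unfolding pseudocharacter_def
  using least_card_attained[of "{\<U>. \<U> \<subseteq> {U. openin \<tau> U \<and> x \<in> U} \<and> \<Inter>\<U> = \<Inter>{U. openin \<tau> U \<and> x \<in> U}}"]
  by blast

locale monoid_act = monoid G for G (structure) +
  fixes X :: "'x set" and act :: "'g \<Rightarrow> 'x \<Rightarrow> 'x"
  assumes act_closed: "\<lbrakk>g \<in> carrier G; x \<in> X\<rbrakk> \<Longrightarrow> act g x \<in> X"
    and act_mult: "\<lbrakk>f \<in> carrier G; g \<in> carrier G; x \<in> X\<rbrakk> \<Longrightarrow> act f (act g x) = act (f \<otimes> g) x"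
    and act_one: "x \<in> X \<Longrightarrow> act \<one> x = x"

definition act_topology ::
  "('g, 'm) monoid_scheme \<Rightarrow> 'x set \<Rightarrow> ('g \<Rightarrow> 'x \<Rightarrow> 'x) \<Rightarrow> 'x topology \<Rightarrow> bool" where
  "act_topology G X act \<tau> \<longleftrightarrow>
     topspace \<tau> = X \<and> (\<forall>g\<in>carrier G. continuous_map \<tau> \<tau> (act g))"

text \<open>The whole set \<open>X\<close>, as the empty intersection, is inserted because the library lets
  \<open>topology_generated_by \<S>\<close> live on \<open>\<Union>\<S>\<close>, which misses the point of a one-point act.\<close>

definition zariski_topology ::
  "('g, 'm) monoid_scheme \<Rightarrow> 'x set \<Rightarrow> ('g \<Rightarrow> 'x \<Rightarrow> 'x) \<Rightarrow> 'x topology" where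
  "zariski_topology G X act = topology_generated_by
     (insert X ({{x \<in> X. act f x \<noteq> act g x} | f g. f \<in> carrier G \<and> g \<in> carrier G}
              \<union> {{x \<in> X. act f x \<noteq> c} | f c. f \<in> carrier G \<and> c \<in> X}))"

lemma topspace_zariski_topology: "topspace (zariski_topology G X act) = X"
  unfolding zariski_topology_def topology_generated_by_topspace by blast

lemma (in monoid_act) t1_space_zariski_topology: "t1_space (zariski_topology G X act)"
  unfolding t1_space_def topspace_zariski_topology
proof (intro ballI impI)
  fix x y assume xy: "x \<in> X" "y \<in> X" "x \<noteq> y"
  have "openin (zariski_topology G X act) {z \<in> X. act \<one> z \<noteq> y}"
    unfolding zariski_topology_def
    by (rule topology_generated_by_Basis) (use xy in blast)
  with xy show "\<exists>U. openin (zariski_topology G X act) U \<and> x \<in> U \<and> y \<notin> U"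
    by (intro exI[of _ "{z \<in> X. act \<one> z \<noteq> y}"]) (auto simp: act_one)
qed

text \<open>Normal here includes \<open>T\<^sub>1\<close>, which the library's \<open>normal_space\<close> does not.\<close>

definition hereditarily_normal :: "'a topology \<Rightarrow> bool" where
  "hereditarily_normal = hereditarily (\<lambda>\<tau>. t1_space \<tau> \<and> normal_space \<tau>)"

end

(*
Choose points x_alpha (alpha < kappa) by transfinite recursion so that each x_alpha avoids fewer
than kappa Zariski closed sets not containing x0: those given by an increasing exhaustion H_alpha
of G by sets of size less than kappa and by the points reached earlier. Every filter F on kappa
containing the tails then induces the finest G-topology in which x_alpha converges to x0 along F:
U is open iff g x_alpha is eventually in U whenever g x0 is in U. A point z = g x_alpha with g in
H_alpha and g x0 different from z determines alpha and its "parent" g x0, so points are arranged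
in a forest and the descendants of y inside U witness monotone normality. For the same reason the
pseudocharacter at x0 is the least number of members of F with empty intersection, and F can be
recovered from its topology. It remains to find 2^(2^kappa) filters for which this number is mu.
*)
theory Submission
  imports "HOL-Algebra.Free_Abelian_Groups" Defs
begin

section \<open>Cardinals\<close>

lemma Cinfinite_trans:
  assumes "Cinfinite r" "(a, b) \<in> r" "(b, c) \<in> r"
  shows "(a, c) \<in> r"
  using assms unfolding card_order_on_def well_order_on_def linear_order_on_def
    partial_order_on_def preorder_on_def by (meson transD)

lemma Cinfinite_antisym:
  assumes "Cinfinite r" "(a, b) \<in> r" "(b, a) \<in> r"
  shows "a = b"
  using assms unfolding card_order_on_def well_order_on_def linear_order_on_def
    partial_order_on_def by (meson antisymD)

lemma Cinfinite_refl:
  assumes "Cinfinite r" "a \<in> Field r"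
  shows "(a, a) \<in> r"
  using assms unfolding card_order_on_def well_order_on_def linear_order_on_def
    partial_order_on_def preorder_on_def by (meson refl_onD)

lemma Cinfinite_linear:
  assumes "Cinfinite r" "a \<in> Field r" "b \<in> Field r"
  shows "(a, b) \<in> r \<or> (b, a) \<in> r"
  using assms Cinfinite_refl[OF assms(1,2)]
  unfolding card_order_on_def well_order_on_def linear_order_on_def total_on_def by metis

lemma Cinfinite_upper_bound:
  assumes "Cinfinite r" "a \<in> Field r" "b \<in> Field r"
  obtains c where "c \<in> Field r" "(a, c) \<in> r" "(b, c) \<in> r"
  using Cinfinite_linear[OF assms] Cinfinite_refl[OF assms(1)] assms(2,3) by metis

lemma Cinfinite_no_max:
  assumes "Cinfinite r" "a \<in> Field r"
  obtains b where "b \<in> Field r" "a \<noteq> b" "(a, b) \<in> r"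
  using infinite_Card_order_limit[of r a] assms unfolding cinfinite_def by metis

lemma Cinfinite_Field_nonempty: "Cinfinite r \<Longrightarrow> Field r \<noteq> {}"
  unfolding cinfinite_def by auto

lemma finite_ordLess_Cinfinite:
  assumes "Cinfinite r" "finite A"
  shows "|A| <o r"
proof -
  have "|A| <o |Field r|"
    using assms unfolding cinfinite_def by (intro finite_ordLess_infinite2) auto
  then show ?thesis
    using card_of_Field_ordIso[of r] assms ordLess_ordIso_trans by blast
qed

lemma Un_ordLess_Cinfinite:
  assumes "Cinfinite r" "|A| <o r" "|B| <o r"
  shows "|A \<union> B| <o r"
  using assms card_of_Un_ordLess_infinite_Field unfolding cinfinite_def by blast

lemma Times_ordLess_Cinfinite:
  assumes "Cinfinite r" "|A| <o r" "|B| <o r"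
  shows "|A \<times> B| <o r"
  using assms card_of_Times_ordLess_infinite_Field unfolding cinfinite_def by blast

lemma image_ordLess:
  assumes "|A| <o r"
  shows "|f ` A| <o r"
  using assms card_of_image ordLeq_ordLess_trans by blast

lemma image_times_ordLess_Cinfinite:
  assumes "Cinfinite r" "|A| <o r" "|B| <o r"
  shows "|{h a b | a b. a \<in> A \<and> b \<in> B}| <o r"
proof -
  have "{h a b | a b. a \<in> A \<and> b \<in> B} = (\<lambda>(a, b). h a b) ` (A \<times> B)"
    by auto
  with image_ordLess[OF Times_ordLess_Cinfinite[OF assms]] show ?thesis
    by metis
qed

text \<open>A union of finite sets over an infinite index set is no larger than that index set, so
  the bound holds for singular \<open>r\<close> as well.\<close>

lemma UN_finite_ordLess_Cinfinite:
  assumes "Cinfinite r" "|I| <o r" "\<And>i. i \<in> I \<Longrightarrow> finite (A i)"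
  shows "|\<Union>i\<in>I. A i| <o r"
proof (cases "finite I")
  case True
  then have "finite (\<Union>i\<in>I. A i)"
    using assms(3) by (rule finite_UN_I)
  then show ?thesis
    by (rule finite_ordLess_Cinfinite[OF assms(1)])
next
  case False
  have "|\<Union>i\<in>I. A i| \<le>o |I|"
  proof (rule card_of_UNION_ordLeq_infinite[OF False])
    show "\<forall>i\<in>I. |A i| \<le>o |I|"
    proof
      fix i assume "i \<in> I"
      then show "|A i| \<le>o |I|"
        by (intro ordLess_imp_ordLeq finite_ordLess_infinite2 assms(3) False)
    qed
  qed (rule ordIso_imp_ordLeq[OF card_of_refl])
  then show ?thesis
    using assms(2) by (rule ordLeq_ordLess_trans)
qed

lemma cf_ordLeq:
  assumes "Cinfinite r"
  shows "cf r \<le>o r"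
proof -
  have "cf r \<le>o |Field r|"
    unfolding cf_def using cofinal_Field[OF assms] by (intro least_card_le) auto
  then show ?thesis
    using card_of_Field_ordIso assms ordLeq_ordIso_trans by blast
qed

text \<open>A set smaller than the cofinality is not cofinal: some \<open>b\<close> has no member of
  \<open>A\<close> strictly above it, and by linearity this \<open>b\<close> is an upper
  bound.\<close>

lemma bounded_if_ordLess_cf:
  assumes r: "Cinfinite r" and "A \<subseteq> Field r" "|A| <o cf r"
  obtains b where "b \<in> Field r" "\<And>a. a \<in> A \<Longrightarrow> (a, b) \<in> r"
proof -
  have "\<not> cofinal A r"
  proof
    assume "cofinal A r"
    then have "cf r \<le>o |A|"
      unfolding cf_def using assms by (intro least_card_le) auto
    then show False
      using assms(3) not_ordLess_ordLeq by blast
  qed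
  then obtain b where b: "b \<in> Field r" "\<forall>a\<in>A. \<not> (b \<noteq> a \<and> (b, a) \<in> r)"
    unfolding cofinal_def by blast
  show thesis
  proof (rule that[OF b(1)])
    fix a assume "a \<in> A"
    then show "(a, b) \<in> r"
      using b assms(2) Cinfinite_linear[OF r, of a b] Cinfinite_refl[OF r, of b]
      by (metis subsetD)
  qed
qed

text \<open>\<open>Field r\<close> maps onto \<open>B \<times> Field r\<close>. After projection to
  \<open>B\<close>, the fiber over \<open>b\<close> still maps onto \<open>Field r\<close>, so it
  has full size and fits into no proper initial segment.\<close>

lemma exists_cofinal_fibers:
  fixes r :: "'k rel" and B :: "'b set"
  assumes r: "Cinfinite r" and B: "|B| \<le>o r" "B \<noteq> {}"
  obtains p where "p ` Field r = B"
    "\<And>b \<beta>. b \<in> B \<Longrightarrow> \<beta> \<in> Field r \<Longrightarrow> \<exists>\<alpha>\<in>Field r. (\<beta>, \<alpha>) \<in> r \<and> p \<alpha> = b"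
proof -
  let ?I = "Field r"
  have I: "|?I| =o r" "infinite ?I" "?I \<noteq> {}"
    using r card_of_Field_ordIso Cinfinite_Field_nonempty unfolding cinfinite_def by auto
  have "|B| \<le>o |?I|"
    using B(1) I(1) ordIso_symmetric ordLeq_ordIso_trans by blast
  then have "|B \<times> ?I| \<le>o |?I|"
    by (intro card_of_Times_ordLeq_infinite I(2) ordIso_imp_ordLeq[OF card_of_refl])
  moreover have "B \<times> ?I \<noteq> {}"
    using B I by auto
  ultimately obtain h where h: "h ` ?I = B \<times> ?I"
    using card_of_ordLeq2[of "B \<times> ?I" ?I] by auto
  show thesis
  proof
    show "(fst \<circ> h) ` ?I = B"
      unfolding image_comp[symmetric] h using I by auto
    fix b \<beta> assume b: "b \<in> B" and \<beta>: "\<beta> \<in> ?I"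
    show "\<exists>\<alpha>\<in>?I. (\<beta>, \<alpha>) \<in> r \<and> (fst \<circ> h) \<alpha> = b"
    proof (rule ccontr)
      assume no: "\<not> ?thesis"
      let ?S = "{\<alpha> \<in> ?I. fst (h \<alpha>) = b}"
      have "?S \<subseteq> underS r \<beta>"
        using no Cinfinite_linear[OF r] Cinfinite_refl[OF r] \<beta> unfolding underS_def by fastforce
      then have "|?S| <o r"
        using card_of_underS[of r \<beta>] \<beta> r card_of_mono1 ordLeq_ordLess_trans by blast
      moreover have "?I \<subseteq> (snd \<circ> h) ` ?S"
      proof
        fix i assume "i \<in> ?I"
        then have "(b, i) \<in> h ` ?I" using h b by auto
        then obtain \<alpha> where "\<alpha> \<in> ?I" "h \<alpha> = (b, i)" by auto
        then show "i \<in> (snd \<circ> h) ` ?S" by force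
      qed
      ultimately have "|?I| <o r"
        by (meson card_of_image card_of_mono1 ordLeq_ordLess_trans ordLeq_transitive)
      then show False
        using I(1) not_ordLess_ordIso by blast
    qed
  qed
qed

lemma Pow_Pow_Field_ordIso:
  assumes "Card_order r"
  shows "|Pow (Pow (Field r))| =o ctwo ^c (ctwo ^c r)"
proof -
  have "|Pow (Pow (Field r))| =o ctwo ^c |Pow (Field r)|"
    by (rule Pow_cexp_ctwo)
  moreover have "|Pow (Field r)| =o ctwo ^c r"
    using Pow_cexp_ctwo[of "Field r"] cexp_cong2[OF card_of_Field_ordIso[OF assms]]
      Card_order_ctwo card_of_Card_order ordIso_transitive by blast
  ultimately show ?thesis
    using cexp_cong2[of "|Pow (Field r)|" "ctwo ^c r" ctwo] Card_order_ctwo card_of_Card_order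
      ordIso_transitive by blast
qed

section \<open>Monotone normality\<close>

text \<open>This is the Borges form of monotone normality. If \<open>C = C' \<inter> S\<close> and
  \<open>D = D' \<inter> S\<close> are disjoint, then \<open>C\<close> misses \<open>D'\<close> and
  \<open>D\<close> misses \<open>C'\<close>. Applying \<open>V\<close> to the points of one set and
  the open complement for the other gives open sets that are disjoint in the whole space, not only
  on \<open>S\<close>.\<close>

lemma monotone_normal_imp_hereditarily_normal:
  assumes t1: "t1_space \<tau>"
    and V: "\<And>x U. \<lbrakk>openin \<tau> U; x \<in> U\<rbrakk> \<Longrightarrow> openin \<tau> (V x U) \<and> x \<in> V x U"
    and meet: "\<And>x U y W. \<lbrakk>openin \<tau> U; x \<in> U; openin \<tau> W; y \<in> W; V x U \<inter> V y W \<noteq> {}\<rbrakk>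
      \<Longrightarrow> x \<in> W \<or> y \<in> U"
  shows "hereditarily_normal \<tau>"
  unfolding hereditarily_normal_def hereditarily
proof
  fix S
  have "normal_space (subtopology \<tau> S)"
    unfolding normal_space_def
  proof (intro allI impI, elim conjE)
    fix C D assume "closedin (subtopology \<tau> S) C" "closedin (subtopology \<tau> S) D" and dis: "disjnt C D"
    then obtain C' D' where C: "closedin \<tau> C'" "C = C' \<inter> S" and D: "closedin \<tau> D'" "D = D' \<inter> S"
      unfolding closedin_subtopology by blast
    let ?C = "topspace \<tau> - C'" and ?D = "topspace \<tau> - D'"
    have op: "openin \<tau> ?C" "openin \<tau> ?D"
      using C D by blast+
    have sub: "C \<subseteq> ?D" "D \<subseteq> ?C"
      using dis C D closedin_subset unfolding disjnt_def by blast+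
    let ?P = "\<Union>x\<in>C. V x ?D" and ?Q = "\<Union>y\<in>D. V y ?C"
    have PQ: "openin \<tau> ?P" "openin \<tau> ?Q" "C \<subseteq> ?P" "D \<subseteq> ?Q"
      using V op sub by blast+
    have "?P \<inter> ?Q = {}"
    proof (rule ccontr)
      assume "?P \<inter> ?Q \<noteq> {}"
      then obtain x y where "x \<in> C" "y \<in> D" "V x ?D \<inter> V y ?C \<noteq> {}"
        by blast
      then have "x \<in> ?C \<or> y \<in> ?D"
        using meet[OF op(2) _ op(1)] sub by blast
      then show False
        using \<open>x \<in> C\<close> \<open>y \<in> D\<close> C D by blast
    qed
    then show "\<exists>U W. openin (subtopology \<tau> S) U \<and> openin (subtopology \<tau> S) W
        \<and> C \<subseteq> U \<and> D \<subseteq> W \<and> disjnt U W"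
      using PQ C(2) D(2)
      by (intro exI[of _ "?P \<inter> S"] exI[of _ "?Q \<inter> S"])
        (auto simp: disjnt_def intro!: openin_subtopology_Int)
  qed
  then show "t1_space (subtopology \<tau> S) \<and> normal_space (subtopology \<tau> S)"
    using t1 t1_space_subtopology by blast
qed

text \<open>Predecessors are unique, so the two paths traced back from \<open>z\<close> agree as
  long as both last. The shorter one ends on the longer one.\<close>

lemma rtrancl_comparable:
  assumes uniq: "\<And>a b c. (a, c) \<in> r \<union> s \<Longrightarrow> (b, c) \<in> r \<union> s \<Longrightarrow> a = b"
    and "(y, z) \<in> s\<^sup>*" "(x, z) \<in> r\<^sup>*"
  shows "(x, y) \<in> r\<^sup>* \<or> (y, x) \<in> s\<^sup>*"
  using assms(2,3)
proof (induction rule: rtrancl_induct)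
  case base
  then show ?case by blast
next
  case (step w z)
  from step.prems show ?case
  proof (cases rule: rtranclE)
    case base
    then show ?thesis using step.hyps by (meson rtrancl.rtrancl_into_rtrancl)
  next
    case (step v)
    then have "v = w" using \<open>(w, z) \<in> s\<close> uniq by blast
    then show ?thesis using step \<open>(x, w) \<in> r\<^sup>* \<Longrightarrow> _\<close> by blast
  qed
qed

lemma t1_space_Inter_open:
  assumes "t1_space \<tau>" "x \<in> topspace \<tau>"
  shows "\<Inter>{U. openin \<tau> U \<and> x \<in> U} = {x}"
proof -
  have "\<exists>U. openin \<tau> U \<and> x \<in> U \<and> y \<notin> U" if "y \<noteq> x" for y
    using assms that unfolding t1_space_def by (metis openin_topspace)
  then show ?thesis by auto
qed

section \<open>Transfinite sequences of Zariski generic points\<close>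

text \<open>The subbasic Zariski neighborhoods of \<open>x0\<close> with data in \<open>H\<close>
  and \<open>C\<close> are fewer than the pseudocharacter, so they share a point other than
  \<open>x0\<close>. Such a point satisfies an equation with these data only if \<open>x0\<close>
  does.\<close>

lemma (in monoid_act) exists_generic_point:
  assumes x0: "x0 \<in> X" and r: "Cinfinite r" "r \<le>o pseudocharacter (zariski_topology G X act) x0"
    and H: "H \<subseteq> carrier G" "|H| <o r" and C: "C \<subseteq> X" "|C| <o r"
  shows "\<exists>x. x \<in> X \<and> x \<noteq> x0 \<and> (\<forall>f\<in>H. \<forall>g\<in>H. act f x = act g x \<longrightarrow> act f x0 = act g x0)
    \<and> (\<forall>f\<in>H. \<forall>c\<in>C. act f x = c \<longrightarrow> act f x0 = c)"
proof -
  let ?Z = "zariski_topology G X act"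
  let ?A = "{{x \<in> X. act f x \<noteq> act g x} | f g. f \<in> H \<and> g \<in> H}"
    and ?B = "{{x \<in> X. act f x \<noteq> c} | f c. f \<in> H \<and> c \<in> C}"
  \<comment> \<open>\<open>X\<close> is put in so that the common points lie in \<open>X\<close>
    even if no other set contains \<open>x0\<close>.\<close>
  define \<U> where "\<U> = {U \<in> {X} \<union> (?A \<union> ?B). x0 \<in> U}"
  have "|{X} \<union> (?A \<union> ?B)| <o r"
    using r(1) finite_ordLess_Cinfinite[OF r(1), of "{X}", simplified]
      image_times_ordLess_Cinfinite[OF r(1) H(2) H(2)] image_times_ordLess_Cinfinite[OF r(1) H(2) C(2)]
    by (intro Un_ordLess_Cinfinite)
  moreover have "|\<U>| \<le>o |{X} \<union> (?A \<union> ?B)|"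
    unfolding \<U>_def by (intro card_of_mono1) blast
  ultimately have small: "|\<U>| <o r"
    using ordLeq_ordLess_trans by blast
  have "openin ?Z U" if "U \<in> {X} \<union> (?A \<union> ?B)" for U
    unfolding zariski_topology_def
    by (rule topology_generated_by_Basis) (use that H C in blast)
  then have open\<U>: "\<U> \<subseteq> {U. openin ?Z U \<and> x0 \<in> U}"
    unfolding \<U>_def by (intro subsetI) simp
  have all: "\<Inter>{U. openin ?Z U \<and> x0 \<in> U} = {x0}"
    using t1_space_Inter_open[OF t1_space_zariski_topology] x0 topspace_zariski_topology by metis
  have "\<Inter>\<U> \<noteq> {x0}"
  proof
    assume "\<Inter>\<U> = {x0}"
    then have "pseudocharacter ?Z x0 \<le>o |\<U>|"
      unfolding pseudocharacter_def all by (intro least_card_le CollectI conjI open\<U>)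
    then show False
      using small r(2) not_ordLess_ordLeq ordLeq_transitive by blast
  qed
  moreover have "x0 \<in> \<Inter>\<U>" unfolding \<U>_def by blast
  ultimately obtain x where x: "x \<in> \<Inter>\<U>" "x \<noteq> x0" by blast
  have "x \<in> X" using x(1) x0 unfolding \<U>_def by blast
  moreover have "act f x0 = act g x0" if "f \<in> H" "g \<in> H" "act f x = act g x" for f g
  proof (rule ccontr)
    assume "act f x0 \<noteq> act g x0"
    then have "{x \<in> X. act f x \<noteq> act g x} \<in> \<U>" unfolding \<U>_def using that x0 by blast
    then show False using x(1) that by blast
  qed
  moreover have "act f x0 = c" if "f \<in> H" "c \<in> C" "act f x = c" for f c
  proof (rule ccontr)
    assume "act f x0 \<noteq> c"
    then have "{x \<in> X. act f x \<noteq> c} \<in> \<U>" unfolding \<U>_def using that x0 by blast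
    then show False using x(1) that by blast
  qed
  ultimately show ?thesis using x(2) by blast
qed

text \<open>Each kind of genericity has its own task: \<open>x_generic_old\<close> makes the index
  of a moved point unique, \<open>x_generic\<close> then makes its parent unique, and
  \<open>x_generic_x0\<close> ensures that \<open>x0\<close> has no parent.\<close>

locale generic_sequence = monoid_act G X act
  for G :: "('g, 'm) monoid_scheme" (structure) and X :: "'x set" and act +
  fixes x0 and r :: "'k rel" and H :: "'k \<Rightarrow> 'g set" and x :: "'k \<Rightarrow> 'x"
  assumes x0_in: "x0 \<in> X"
    and r: "Cinfinite r"
    and H_carrier: "H \<alpha> \<subseteq> carrier G"
    and one_in_H: "\<one> \<in> H \<alpha>"
    and H_mono: "(\<alpha>, \<beta>) \<in> r \<Longrightarrow> H \<alpha> \<subseteq> H \<beta>"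
    and H_cover: "g \<in> carrier G \<Longrightarrow> \<exists>\<alpha>\<in>Field r. g \<in> H \<alpha>"
    and x_in: "x \<alpha> \<in> X"
    and x_neq: "x \<alpha> \<noteq> x0"
    and x_generic: "\<lbrakk>f \<in> H \<alpha>; g \<in> H \<alpha>; act f (x \<alpha>) = act g (x \<alpha>)\<rbrakk> \<Longrightarrow> act f x0 = act g x0"
    and x_generic_x0: "\<lbrakk>f \<in> H \<alpha>; g \<in> H \<alpha>; act f (x \<alpha>) = act g x0\<rbrakk> \<Longrightarrow> act f x0 = act g x0"
    and x_generic_old: "\<lbrakk>f \<in> H \<alpha>; g \<in> H \<alpha>; (\<beta>, \<alpha>) \<in> r; \<beta> \<noteq> \<alpha>; act f (x \<alpha>) = act g (x \<beta>)\<rbrakk>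
      \<Longrightarrow> act f x0 = act g (x \<beta>)"

lemma (in monoid_act) exists_generic_sequence:
  assumes x0: "x0 \<in> X" and r: "Cinfinite r" "r \<le>o pseudocharacter (zariski_topology G X act) x0"
    and G: "|carrier G| \<le>o r"
  shows "\<exists>H x. generic_sequence G X act x0 r H x"
proof -
  have "|carrier G| \<le>o |Field r|"
    using G r card_of_Field_ordIso ordIso_symmetric ordLeq_ordIso_trans by blast
  then obtain e where e: "e ` Field r = carrier G"
    using card_of_ordLeq2[of "carrier G" "Field r"] by auto
  \<comment> \<open>The strict initial segment keeps \<open>H \<alpha>\<close> smaller than
    \<open>r\<close> even when the monoid has size \<open>r\<close>; the unit is added so that it is
    present from the first stage on.\<close>
  define H where "H \<alpha> = insert \<one> (e ` underS r \<alpha>)" for \<alpha>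
  have HG: "H \<alpha> \<subseteq> carrier G" for \<alpha>
    using e unfolding H_def underS_def Field_def by blast
  \<comment> \<open>The sequence is defined on the whole type; an index outside
    \<open>Field r\<close> has an empty initial segment.\<close>
  have under: "|underS r \<alpha>| <o r" for \<alpha>
  proof (cases "\<alpha> \<in> Field r")
    case True
    then show ?thesis using card_of_underS[of r \<alpha>] r(1) by simp
  next
    case False
    then have "underS r \<alpha> = {}" unfolding underS_def by (auto intro: FieldI2)
    then show ?thesis using finite_ordLess_Cinfinite[OF r(1), of "{}"] by simp
  qed
  have "|{\<one>} \<union> e ` underS r \<alpha>| <o r" for \<alpha>
    by (intro Un_ordLess_Cinfinite image_ordLess r(1) under finite_ordLess_Cinfinite[OF r(1), of "{\<one>}"]) simp
  then have H_small: "|H \<alpha>| <o r" for \<alpha>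
    unfolding H_def by simp
  \<comment> \<open>The values to be avoided come from \<open>x0\<close> as well as from earlier
    points; the former yield \<open>x_generic_x0\<close>, the latter
    \<open>x_generic_old\<close>.\<close>
  define C where "C y \<alpha> = {act g z | g z. g \<in> H \<alpha> \<and> z \<in> insert x0 (y ` underS r \<alpha>)}"
    for y :: "_ \<Rightarrow> 'x" and \<alpha>
  define P where "P y \<alpha> z \<longleftrightarrow> z \<in> X \<and> z \<noteq> x0
    \<and> (\<forall>f\<in>H \<alpha>. \<forall>g\<in>H \<alpha>. act f z = act g z \<longrightarrow> act f x0 = act g x0)
    \<and> (\<forall>f\<in>H \<alpha>. \<forall>c\<in>C y \<alpha>. act f z = c \<longrightarrow> act f x0 = c)" for y \<alpha> z
  \<comment> \<open>Recursion along \<open>r - Id\<close>: \<open>P y \<alpha>\<close> depends on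
    \<open>y\<close> only through its values at strict predecessors of \<alpha>.\<close>
  have "\<exists>y. \<forall>\<alpha>. P y \<alpha> (y \<alpha>)"
  proof (rule dependent_wf_choice[where P = P])
    show "wf (r - Id)"
      using r(1) unfolding card_order_on_def well_order_on_def by blast
  next
    fix y y' :: "_ \<Rightarrow> 'x" and \<alpha> z assume "\<And>\<beta>. (\<beta>, \<alpha>) \<in> r - Id \<Longrightarrow> y \<beta> = y' \<beta>"
    then have "y ` underS r \<alpha> = y' ` underS r \<alpha>"
      unfolding underS_def by (intro image_cong) auto
    then show "P y \<alpha> z = P y' \<alpha> z"
      unfolding P_def C_def by simp
  next
    fix \<alpha> and y :: "_ \<Rightarrow> 'x" assume y: "\<And>\<beta>. (\<beta>, \<alpha>) \<in> r - Id \<Longrightarrow> P y \<beta> (y \<beta>)"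
    have "|{x0} \<union> y ` underS r \<alpha>| <o r"
      by (intro Un_ordLess_Cinfinite image_ordLess r(1) under finite_ordLess_Cinfinite[OF r(1), of "{x0}"]) simp
    then have "|insert x0 (y ` underS r \<alpha>)| <o r"
      by simp
    then have "|C y \<alpha>| <o r"
      unfolding C_def by (rule image_times_ordLess_Cinfinite[OF r(1) H_small])
    moreover have "C y \<alpha> \<subseteq> X"
    proof -
      have "y \<beta> \<in> X" if "\<beta> \<in> underS r \<alpha>" for \<beta>
        using y[of \<beta>] that unfolding P_def underS_def by auto
      then have "insert x0 (y ` underS r \<alpha>) \<subseteq> X" using x0 by blast
      then show ?thesis unfolding C_def using HG act_closed by blast
    qed
    ultimately show "\<exists>z. P y \<alpha> z"
      unfolding P_def using exists_generic_point[OF x0 r HG H_small] by simp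
  qed
  then obtain x where "\<forall>\<alpha>. P x \<alpha> (x \<alpha>)" ..
  then have x: "P x \<alpha> (x \<alpha>)" for \<alpha> ..
  have x_C: "act f x0 = c" if "f \<in> H \<alpha>" "c \<in> C x \<alpha>" "act f (x \<alpha>) = c" for f c \<alpha>
    using x[of \<alpha>] that unfolding P_def by blast
  have "generic_sequence G X act x0 r H x"
  proof (unfold_locales)
    fix \<alpha> \<beta> assume ab: "(\<alpha>, \<beta>) \<in> r"
    have "(\<gamma>, \<beta>) \<in> r \<and> \<gamma> \<noteq> \<beta>" if "(\<gamma>, \<alpha>) \<in> r" "\<gamma> \<noteq> \<alpha>" for \<gamma>
      using Cinfinite_trans[OF r(1) that(1) ab] Cinfinite_antisym[OF r(1) ab] that by metis
    then have "underS r \<alpha> \<subseteq> underS r \<beta>"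
      unfolding underS_def by blast
    then show "H \<alpha> \<subseteq> H \<beta>"
      unfolding H_def by blast
  next
    fix g assume "g \<in> carrier G"
    then obtain \<beta> where \<beta>: "\<beta> \<in> Field r" "g = e \<beta>" using e by blast
    \<comment> \<open>The element \<open>e \<beta>\<close> is sure to be in \<open>H\<close> only
      strictly after \<beta>; a later index exists because \<open>r\<close> has no maximum.\<close>
    then obtain \<alpha> where "\<alpha> \<in> Field r" "\<beta> \<noteq> \<alpha>" "(\<beta>, \<alpha>) \<in> r"
      using Cinfinite_no_max[OF r(1)] by metis
    then show "\<exists>\<alpha>\<in>Field r. g \<in> H \<alpha>"
      using \<beta> unfolding H_def underS_def by blast
  next
    fix f g \<alpha> assume "f \<in> H \<alpha>" "g \<in> H \<alpha>" "act f (x \<alpha>) = act g x0"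
    then show "act f x0 = act g x0"
      by (intro x_C[of f \<alpha>]) (auto simp: C_def)
  next
    fix f g \<alpha> \<beta> assume "f \<in> H \<alpha>" "g \<in> H \<alpha>" "(\<beta>, \<alpha>) \<in> r" "\<beta> \<noteq> \<alpha>" "act f (x \<alpha>) = act g (x \<beta>)"
    then show "act f x0 = act g (x \<beta>)"
      by (intro x_C[of f \<alpha>]) (auto simp: C_def underS_def)
  next
    show "\<one> \<in> H \<alpha>" for \<alpha>
      unfolding H_def by blast
  next
    fix f g \<alpha> assume "f \<in> H \<alpha>" "g \<in> H \<alpha>" "act f (x \<alpha>) = act g (x \<alpha>)"
    then show "act f x0 = act g x0"
      using x[of \<alpha>] unfolding P_def by blast
  next
    show "x \<alpha> \<in> X" "x \<alpha> \<noteq> x0" for \<alpha>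
      using x[of \<alpha>] unfolding P_def by blast+
  qed (use x0 r(1) HG in simp_all)
  then show ?thesis by blast
qed

section \<open>The forest of parents and the topology induced by a filter\<close>

context generic_sequence
begin

text \<open>If \<alpha> comes before \<beta>, then \<open>f\<close> also lies in
  \<open>H \<beta>\<close>, and \<open>act g (x \<beta>) = act f (x \<alpha>)\<close> is a
  coincidence with an earlier point. Genericity carries it over to \<open>x0\<close>, so
  \<open>act g x0 = z\<close>, a contradiction.\<close>

lemma index_unique:
  assumes \<alpha>: "\<alpha> \<in> Field r" "f \<in> H \<alpha>" "act f (x \<alpha>) = z" "act f x0 \<noteq> z"
    and \<beta>: "\<beta> \<in> Field r" "g \<in> H \<beta>" "act g (x \<beta>) = z" "act g x0 \<noteq> z"
  shows "\<alpha> = \<beta>"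
proof (rule ccontr)
  assume "\<alpha> \<noteq> \<beta>"
  then consider "(\<alpha>, \<beta>) \<in> r" | "(\<beta>, \<alpha>) \<in> r"
    using Cinfinite_linear[OF r \<alpha>(1) \<beta>(1)] by blast
  then show False
  proof cases
    case 1
    then have "f \<in> H \<beta>" using H_mono \<alpha> by blast
    then show ?thesis using x_generic_old[of g \<beta> f \<alpha>] 1 \<alpha> \<beta> \<open>\<alpha> \<noteq> \<beta>\<close> by simp
  next
    case 2
    then have "g \<in> H \<alpha>" using H_mono \<beta> by blast
    then show ?thesis using x_generic_old[of f \<alpha> g \<beta>] 2 \<alpha> \<beta> \<open>\<alpha> \<noteq> \<beta>\<close> by simp
  qed
qed

definition parent :: "('x \<times> 'x) set" where
  "parent = {(y, z). y \<noteq> z \<and> (\<exists>\<alpha>\<in>Field r. \<exists>g\<in>H \<alpha>. act g x0 = y \<and> act g (x \<alpha>) = z)}"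

text \<open>Both representations of \<open>z\<close> use the same index, and then
  \<open>x_generic\<close> turns equality of \<open>g\<close> and \<open>h\<close> at
  \<open>x \<alpha>\<close> into equality at \<open>x0\<close>.\<close>

lemma parent_unique:
  assumes "(y, z) \<in> parent" "(y', z) \<in> parent"
  shows "y = y'"
proof -
  obtain \<alpha> g where \<alpha>: "\<alpha> \<in> Field r" "g \<in> H \<alpha>" "act g (x \<alpha>) = z" "act g x0 = y" "y \<noteq> z"
    using assms(1) unfolding parent_def by blast
  obtain \<beta> h where \<beta>: "\<beta> \<in> Field r" "h \<in> H \<beta>" "act h (x \<beta>) = z" "act h x0 = y'" "y' \<noteq> z"
    using assms(2) unfolding parent_def by blast
  have "\<alpha> = \<beta>"
    using index_unique[OF \<alpha>(1-3) _ \<beta>(1-3)] \<alpha> \<beta> by simp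
  then show ?thesis
    using x_generic[OF \<alpha>(2), of h] \<alpha> \<beta> by simp
qed

definition filter_topology :: "'k filter \<Rightarrow> 'x topology" where
  "filter_topology F = topology (\<lambda>U. U \<subseteq> X \<and>
     (\<forall>g\<in>carrier G. act g x0 \<in> U \<longrightarrow> (\<forall>\<^sub>F \<alpha> in F. act g (x \<alpha>) \<in> U)))"

lemma openin_filter_topology:
  "openin (filter_topology F) U \<longleftrightarrow> U \<subseteq> X \<and>
     (\<forall>g\<in>carrier G. act g x0 \<in> U \<longrightarrow> (\<forall>\<^sub>F \<alpha> in F. act g (x \<alpha>) \<in> U))"
proof -
  let ?P = "\<lambda>U. U \<subseteq> X \<and> (\<forall>g\<in>carrier G. act g x0 \<in> U \<longrightarrow> (\<forall>\<^sub>F \<alpha> in F. act g (x \<alpha>) \<in> U))"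
  have "istopology ?P"
    unfolding istopology_def
  proof (intro conjI allI impI)
    fix \<K> assume K: "\<forall>K\<in>\<K>. ?P K"
    have "\<forall>\<^sub>F \<alpha> in F. act g (x \<alpha>) \<in> \<Union>\<K>" if g: "g \<in> carrier G" "act g x0 \<in> \<Union>\<K>" for g
    proof -
      obtain K where "K \<in> \<K>" "act g x0 \<in> K" using g by blast
      then have "\<forall>\<^sub>F \<alpha> in F. act g (x \<alpha>) \<in> K" using K g by blast
      then show ?thesis by (rule eventually_mono) (use \<open>K \<in> \<K>\<close> in blast)
    qed
    then show "\<forall>g\<in>carrier G. act g x0 \<in> \<Union>\<K> \<longrightarrow> (\<forall>\<^sub>F \<alpha> in F. act g (x \<alpha>) \<in> \<Union>\<K>)"
      by blast
    show "\<Union>\<K> \<subseteq> X" using K by blast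
  qed (auto simp: eventually_conj_iff)
  then show ?thesis
    unfolding filter_topology_def by (simp add: topology_inverse')
qed

lemma topspace_filter_topology: "topspace (filter_topology F) = X"
proof (rule subset_antisym)
  have "openin (filter_topology F) X"
    unfolding openin_filter_topology using act_closed x_in by auto
  then show "X \<subseteq> topspace (filter_topology F)"
    by (rule openin_subset)
  show "topspace (filter_topology F) \<subseteq> X"
    using openin_topspace[of "filter_topology F"] unfolding openin_filter_topology by (rule conjunct1)
qed

text \<open>The openness condition at \<open>h\<close> for the preimage of \<open>U\<close> under
  \<open>g\<close> is the condition at \<open>g \<otimes> h\<close> for \<open>U\<close>
  itself.\<close>

lemma act_topology_filter_topology: "act_topology G X act (filter_topology F)"
  unfolding act_topology_def continuous_map topspace_filter_topology
proof (intro conjI ballI allI impI refl)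
  fix g assume g: "g \<in> carrier G"
  show "act g ` X \<subseteq> X" using g act_closed by blast
  fix U assume U: "openin (filter_topology F) U"
  show "openin (filter_topology F) {y \<in> X. act g y \<in> U}"
    unfolding openin_filter_topology
  proof (intro conjI ballI impI)
    fix h assume h: "h \<in> carrier G" "act h x0 \<in> {y \<in> X. act g y \<in> U}"
    then have "act (g \<otimes> h) x0 \<in> U" using act_mult[OF g h(1) x0_in] by auto
    then have "\<forall>\<^sub>F \<alpha> in F. act (g \<otimes> h) (x \<alpha>) \<in> U"
      using U g h unfolding openin_filter_topology by blast
    then show "\<forall>\<^sub>F \<alpha> in F. act h (x \<alpha>) \<in> {y \<in> X. act g y \<in> U}"
      by (rule eventually_mono) (use act_mult[OF g h(1) x_in] act_closed[OF h(1) x_in] in auto)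
  qed blast
qed

lemma eventually_x_if_openin:
  assumes "openin (filter_topology F) U" "x0 \<in> U"
  shows "\<forall>\<^sub>F \<alpha> in F. x \<alpha> \<in> U"
proof -
  have "\<forall>\<^sub>F \<alpha> in F. act \<one> (x \<alpha>) \<in> U"
    using assms unfolding openin_filter_topology by (simp add: act_one[OF x0_in])
  then show ?thesis
    by (simp add: act_one[OF x_in])
qed

text \<open>Points having a parent are kept only if their index lies in \<open>A\<close>; points
  without a parent are all kept. For \<open>A\<close> in the filter this is an open neighborhood of
  \<open>x0\<close> whose trace on the sequence is \<open>A\<close>.\<close>

definition nbhd :: "'k set \<Rightarrow> 'x set" where
  "nbhd A = {z \<in> X. \<forall>\<alpha>\<in>Field r. \<forall>g\<in>H \<alpha>. act g (x \<alpha>) = z \<and> act g x0 \<noteq> z \<longrightarrow> \<alpha> \<in> A}"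

text \<open>\<open>x0\<close> has no parent: by genericity against \<open>x0\<close>, with the unit
  as second element, a \<open>g \<in> H \<alpha>\<close> that maps \<open>x \<alpha>\<close> to
  \<open>x0\<close> fixes \<open>x0\<close>.\<close>

lemma x0_in_nbhd: "x0 \<in> nbhd A"
proof -
  have "act g x0 = x0" if "g \<in> H \<alpha>" "act g (x \<alpha>) = x0" for g \<alpha>
    using x_generic_x0[OF that(1) one_in_H] that(2) act_one[OF x0_in] by simp
  then show ?thesis
    unfolding nbhd_def using x0_in by blast
qed

text \<open>The unit exhibits \<open>x \<alpha>\<close> as a child of \<open>x0\<close> with index
  \<alpha>, and this index is unique. Thus \<open>A\<close> can be read off from
  \<open>nbhd A\<close>.\<close>

lemma x_in_nbhd_iff:
  assumes "\<alpha> \<in> Field r"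
  shows "x \<alpha> \<in> nbhd A \<longleftrightarrow> \<alpha> \<in> A"
proof -
  have 1: "act \<one> (x \<alpha>) = x \<alpha>" "act \<one> x0 \<noteq> x \<alpha>"
    by (simp_all add: act_one x0_in x_in x_neq[symmetric])
  then have "\<beta> = \<alpha>" if "\<beta> \<in> Field r" "g \<in> H \<beta>" "act g (x \<beta>) = x \<alpha>" "act g x0 \<noteq> x \<alpha>" for \<beta> g
    using index_unique[OF that assms one_in_H] by blast
  moreover have "\<alpha> \<in> A" if "x \<alpha> \<in> nbhd A"
    using that assms one_in_H 1 unfolding nbhd_def by blast
  ultimately show ?thesis
    unfolding nbhd_def using x_in by blast
qed

end

section \<open>Filters containing the tails: separation and pseudocharacter\<close>

locale tail_filter = generic_sequence G X act x0 r H x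
  for G :: "('g, 'm) monoid_scheme" (structure) and X :: "'x set" and act x0
    and r :: "'k rel" and H x +
  fixes F :: "'k filter"
  assumes tail: "\<beta> \<in> Field r \<Longrightarrow> \<forall>\<^sub>F \<alpha> in F. (\<beta>, \<alpha>) \<in> r"
begin

lemma eventually_in_H:
  assumes "g \<in> carrier G"
  shows "\<forall>\<^sub>F \<alpha> in F. \<alpha> \<in> Field r \<and> g \<in> H \<alpha>"
proof -
  obtain \<beta> where "\<beta> \<in> Field r" "g \<in> H \<beta>" using H_cover assms by blast
  from tail[OF this(1)] show ?thesis
    by (rule eventually_mono) (use H_mono \<open>g \<in> H \<beta>\<close> in \<open>auto intro: FieldI2\<close>)
qed

text \<open>The complement of a point \<open>c\<close> is open: if
  \<open>act g x0 \<noteq> c\<close>, then \<open>act g (x \<alpha>) = c\<close> for at most one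
  \<alpha> with \<open>g \<in> H \<alpha>\<close>, and a tail beginning strictly later omits that
  index.\<close>

lemma t1_space_filter_topology: "t1_space (filter_topology F)"
  unfolding t1_space_def topspace_filter_topology
proof (intro ballI impI)
  fix y c assume y: "y \<in> X" and "c \<in> X" and "y \<noteq> c"
  have "openin (filter_topology F) (X - {c})"
    unfolding openin_filter_topology
  proof (intro conjI ballI impI)
    fix g assume g: "g \<in> carrier G" "act g x0 \<in> X - {c}"
    have "\<forall>\<^sub>F \<alpha> in F. act g (x \<alpha>) \<noteq> c"
    proof (cases "\<exists>\<alpha>\<in>Field r. g \<in> H \<alpha> \<and> act g (x \<alpha>) = c")
      case True
      then obtain \<alpha> where \<alpha>: "\<alpha> \<in> Field r" "g \<in> H \<alpha>" "act g (x \<alpha>) = c" by blast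
      obtain \<beta> where \<beta>: "\<beta> \<in> Field r" "\<alpha> \<noteq> \<beta>" "(\<alpha>, \<beta>) \<in> r"
        using Cinfinite_no_max[OF r \<alpha>(1)] by blast
      from eventually_in_H[OF g(1)] tail[OF \<beta>(1)] show ?thesis
      proof eventually_elim
        case (elim \<gamma>)
        then have "\<gamma> \<noteq> \<alpha>" using \<beta> Cinfinite_antisym[OF r] by blast
        then show ?case using index_unique[of \<gamma> g c \<alpha> g] elim \<alpha> g by blast
      qed
    next
      case False
      with eventually_in_H[OF g(1)] show ?thesis by (auto elim: eventually_mono)
    qed
    then show "\<forall>\<^sub>F \<alpha> in F. act g (x \<alpha>) \<in> X - {c}"
      by (rule eventually_mono) (use act_closed[OF g(1) x_in] in auto)
  qed blast
  with y \<open>y \<noteq> c\<close> show "\<exists>U. openin (filter_topology F) U \<and> y \<in> U \<and> c \<notin> U" by blast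
qed

text \<open>For large \<alpha> in \<open>A\<close>, either \<open>g\<close> does not separate
  \<open>x \<alpha>\<close> from \<open>x0\<close>, or \<open>act g (x \<alpha>)\<close> has
  \<alpha> as its only index.\<close>

lemma openin_nbhd:
  assumes "\<forall>\<^sub>F \<alpha> in F. \<alpha> \<in> A"
  shows "openin (filter_topology F) (nbhd A)"
  unfolding openin_filter_topology
proof (intro conjI ballI impI)
  show "nbhd A \<subseteq> X" unfolding nbhd_def by blast
  fix g assume g: "g \<in> carrier G" "act g x0 \<in> nbhd A"
  from assms eventually_in_H[OF g(1)] show "\<forall>\<^sub>F \<alpha> in F. act g (x \<alpha>) \<in> nbhd A"
  proof eventually_elim
    case (elim \<alpha>)
    show ?case
    proof (cases "act g (x \<alpha>) = act g x0")
      case False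
      then show ?thesis
        unfolding nbhd_def using elim index_unique[of _ _ "act g (x \<alpha>)" \<alpha> g] act_closed[OF g(1) x_in]
        by auto
    qed (use g in simp)
  qed
qed

text \<open>The descendants of \<open>y\<close> along paths in \<open>U\<close>. The restriction
  concerns only the end of each edge; the start \<open>y\<close> always belongs to the set and is
  assumed to be in \<open>U\<close> where this matters.\<close>

definition reach :: "'x \<Rightarrow> 'x set \<Rightarrow> 'x set" where
  "reach y U = {z. (y, z) \<in> (parent \<inter> UNIV \<times> U)\<^sup>*}"

lemma reach_subset: "y \<in> U \<Longrightarrow> reach y U \<subseteq> U"
  unfolding reach_def by (auto elim: rtranclE)

text \<open>Eventually \<open>act g (x \<alpha>)\<close> lies in \<open>U\<close> and is either
  equal to \<open>act g x0\<close> or a child of it, so the path can be extended.\<close>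

lemma openin_reach:
  assumes U: "openin (filter_topology F) U" "y \<in> U"
  shows "openin (filter_topology F) (reach y U)"
  unfolding openin_filter_topology
proof (intro conjI ballI impI)
  show "reach y U \<subseteq> X"
    using reach_subset U unfolding openin_filter_topology by blast
  fix g assume g: "g \<in> carrier G" "act g x0 \<in> reach y U"
  then have "\<forall>\<^sub>F \<alpha> in F. act g (x \<alpha>) \<in> U"
    using U reach_subset unfolding openin_filter_topology by blast
  with eventually_in_H[OF g(1)] show "\<forall>\<^sub>F \<alpha> in F. act g (x \<alpha>) \<in> reach y U"
  proof eventually_elim
    case (elim \<alpha>)
    show ?case
    proof (cases "act g (x \<alpha>) = act g x0")
      case False
      then have "(act g x0, act g (x \<alpha>)) \<in> parent \<inter> UNIV \<times> U"
        unfolding parent_def using elim by auto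
      then show ?thesis
        using g(2) unfolding reach_def by (auto intro: rtrancl_into_rtrancl)
    qed (use g in simp)
  qed
qed

text \<open>If \<open>w\<close> descends from \<open>y\<close> through \<open>U\<close> and from
  \<open>z\<close> through \<open>W\<close>, then \<open>y\<close> and \<open>z\<close> are two
  ancestors of \<open>w\<close> in a forest, hence comparable. The lower one lies on the path from
  the other and therefore in the open set of the other.\<close>

lemma hereditarily_normal_filter_topology: "hereditarily_normal (filter_topology F)"
proof (rule monotone_normal_imp_hereditarily_normal[where V = reach])
  fix y U z W
  assume "y \<in> U" "z \<in> W" "reach y U \<inter> reach z W \<noteq> {}"
  then obtain w where "(y, w) \<in> (parent \<inter> UNIV \<times> U)\<^sup>*" "(z, w) \<in> (parent \<inter> UNIV \<times> W)\<^sup>*"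
    unfolding reach_def by blast
  then have "(y, z) \<in> (parent \<inter> UNIV \<times> U)\<^sup>* \<or> (z, y) \<in> (parent \<inter> UNIV \<times> W)\<^sup>*"
    by (intro rtrancl_comparable) (blast intro: parent_unique)+
  then have "z \<in> reach y U \<or> y \<in> reach z W"
    unfolding reach_def by simp
  then show "y \<in> W \<or> z \<in> U"
    using reach_subset \<open>y \<in> U\<close> \<open>z \<in> W\<close> by blast
qed (use t1_space_filter_topology openin_reach in \<open>auto simp: reach_def\<close>)


lemma pseudocharacter_ordLeq:
  assumes ev: "\<And>b. b \<in> B \<Longrightarrow> \<forall>\<^sub>F \<alpha> in F. \<alpha> \<in> A b"
    and empty: "\<And>\<alpha>. \<alpha> \<in> Field r \<Longrightarrow> \<exists>b\<in>B. \<alpha> \<notin> A b"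
  shows "pseudocharacter (filter_topology F) x0 \<le>o |B|"
proof -
  \<comment> \<open>\<open>nbhd\<close> alone would keep all points without a parent; inside
    \<open>reach x0\<close> every point except \<open>x0\<close> has a parent, hence an index that
    some \<open>A b\<close> excludes.\<close>
  let ?U = "\<lambda>b. reach x0 (nbhd (A b))"
  have op: "openin (filter_topology F) (?U b) \<and> x0 \<in> ?U b" if "b \<in> B" for b
    using openin_reach[OF openin_nbhd[OF ev[OF that]] x0_in_nbhd] by (auto simp: reach_def)
  have "\<Inter>(?U ` B) = {x0}"
  proof (intro subset_antisym subsetI)
    fix z assume z: "z \<in> \<Inter>(?U ` B)"
    show "z \<in> {x0}"
    proof (rule ccontr)
      assume "z \<notin> {x0}"
      then have last: "\<exists>y. (y, z) \<in> parent \<and> z \<in> nbhd (A b)" if "b \<in> B" for b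
        using z that unfolding reach_def by (auto elim: rtranclE)
      obtain b where "b \<in> B"
        using empty Cinfinite_Field_nonempty[OF r] by blast
      then obtain \<alpha> g where \<alpha>: "\<alpha> \<in> Field r" "g \<in> H \<alpha>" "act g (x \<alpha>) = z" "act g x0 \<noteq> z"
        using last unfolding parent_def by blast
      then obtain c where "c \<in> B" "\<alpha> \<notin> A c" using empty by blast
      then show False using last[of c] \<alpha> unfolding nbhd_def by blast
    qed
  qed (use op in blast)
  moreover have "\<Inter>{U. openin (filter_topology F) U \<and> x0 \<in> U} = {x0}"
    using t1_space_Inter_open[OF t1_space_filter_topology] x0_in topspace_filter_topology by metis
  ultimately have "pseudocharacter (filter_topology F) x0 \<le>o |?U ` B|"
    unfolding pseudocharacter_def using op by (intro least_card_le) auto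
  then show ?thesis
    using card_of_image ordLeq_transitive by blast
qed

text \<open>Each open \<open>U\<close> around \<open>x0\<close> gives the set of all \<alpha> with
  \<open>x \<alpha> \<in> U\<close>, which belongs to \<open>F\<close>. Fewer than \<mu> such sets
  share an index, and its point differs from \<open>x0\<close> while lying in every
  \<open>U\<close>.\<close>

lemma ordLeq_pseudocharacter:
  assumes "Card_order \<mu>"
    and meet: "\<And>\<A>. \<lbrakk>|\<A>| <o \<mu>; \<And>A. A \<in> \<A> \<Longrightarrow> \<forall>\<^sub>F \<alpha> in F. \<alpha> \<in> A\<rbrakk> \<Longrightarrow> \<Inter>\<A> \<noteq> {}"
  shows "\<mu> \<le>o pseudocharacter (filter_topology F) x0"
proof -
  obtain \<U> where \<U>: "\<U> \<subseteq> {U. openin (filter_topology F) U \<and> x0 \<in> U}"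
    "\<Inter>\<U> = \<Inter>{U. openin (filter_topology F) U \<and> x0 \<in> U}"
    "pseudocharacter (filter_topology F) x0 = |\<U>|"
    using pseudocharacter_attained[of "filter_topology F" x0] by blast
  have int: "\<Inter>\<U> = {x0}"
    using \<U>(2) t1_space_Inter_open[OF t1_space_filter_topology] x0_in topspace_filter_topology
    by metis
  have "\<not> |\<U>| <o \<mu>"
  proof
    assume "|\<U>| <o \<mu>"
    then have "|(\<lambda>U. {\<alpha>. x \<alpha> \<in> U}) ` \<U>| <o \<mu>" by (rule image_ordLess)
    then have "\<Inter>((\<lambda>U. {\<alpha>. x \<alpha> \<in> U}) ` \<U>) \<noteq> {}"
    proof (rule meet)
      fix A assume "A \<in> (\<lambda>U. {\<alpha>. x \<alpha> \<in> U}) ` \<U>"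
      then obtain U where "U \<in> \<U>" "A = {\<alpha>. x \<alpha> \<in> U}" by blast
      then show "\<forall>\<^sub>F \<alpha> in F. \<alpha> \<in> A"
        using \<U>(1) eventually_x_if_openin[of F U] by auto
    qed
    then obtain \<alpha> where "x \<alpha> \<in> \<Inter>\<U>" by auto
    then show False using int x_neq by blast
  qed
  then show ?thesis
    unfolding \<U>(3) using assms(1) card_of_Well_order not_ordLeq_iff_ordLess
    unfolding card_order_on_def by metis
qed

end

text \<open>For \<open>A\<close> in \<open>F\<close>, the set \<open>nbhd A\<close> is an open
  neighborhood of \<open>x0\<close> in the common topology, so \<open>x\<close> is eventually in it
  along \<open>F'\<close> too. This recovers the filter from its topology.\<close>

lemma (in generic_sequence) filter_topology_le:
  assumes F: "tail_filter G X act x0 r H x F" and F': "tail_filter G X act x0 r H x F'"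
    and eq: "filter_topology F = filter_topology F'" and A: "\<forall>\<^sub>F \<alpha> in F. \<alpha> \<in> A"
  shows "\<forall>\<^sub>F \<alpha> in F'. \<alpha> \<in> A"
proof -
  have "openin (filter_topology F') (nbhd A)"
    using tail_filter.openin_nbhd[OF F A] eq by simp
  then have "\<forall>\<^sub>F \<alpha> in F'. x \<alpha> \<in> nbhd A"
    using x0_in_nbhd eventually_x_if_openin by blast
  \<comment> \<open>The unit serves only to obtain \<open>\<alpha> \<in> Field r\<close> eventually,
    as \<open>x_in_nbhd_iff\<close> requires.\<close>
  with tail_filter.eventually_in_H[OF F' one_closed] show ?thesis
    by eventually_elim (use x_in_nbhd_iff in blast)
qed

section \<open>Filters from an independent family\<close>

text \<open>Independence of the Hausdorff family: a finite \<open>s\<close> containing a point of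
  each symmetric difference tells the members of \<open>\<Y>\<close> apart by their traces, and the
  second part of the code lists the traces of those in \<open>\<S>\<close>.\<close>

lemma exists_code:
  assumes "finite \<Y>" "\<Y> \<subseteq> Pow I"
  shows "\<exists>j\<in>Fpow I \<times> Fpow (Fpow I). \<forall>Y\<in>\<Y>. Y \<inter> fst j \<in> snd j \<longleftrightarrow> Y \<in> \<S>"
proof -
  define d where "d = (\<lambda>(Y, Y'). SOME i :: 'a. i \<in> (Y - Y') \<union> (Y' - Y))"
  define s where "s = d ` {(Y, Y') \<in> \<Y> \<times> \<Y>. Y \<noteq> Y'}"
  have d: "d (Y, Y') \<in> (Y - Y') \<union> (Y' - Y)" if "Y \<noteq> Y'" for Y Y'
    unfolding d_def prod.case by (rule someI_ex) (use that in blast)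
  have "finite s"
    unfolding s_def using assms(1) by (auto intro: finite_subset[of _ "\<Y> \<times> \<Y>"])
  moreover have "s \<subseteq> I"
  proof
    fix i assume "i \<in> s"
    then obtain Y Y' where Y: "Y \<in> \<Y>" "Y' \<in> \<Y>" "Y \<noteq> Y'" "i = d (Y, Y')"
      unfolding s_def by auto
    then have "i \<in> Y \<union> Y'" using d[OF Y(3)] by blast
    then show "i \<in> I" using Y assms(2) by blast
  qed
  ultimately have s: "s \<in> Fpow I"
    unfolding Fpow_def by blast
  let ?A = "(\<lambda>Y. Y \<inter> s) ` (\<Y> \<inter> \<S>)"
  have "?A \<in> Fpow (Fpow I)"
    using s assms(1) unfolding Fpow_def by auto
  moreover have inj: "Y = Y'" if "Y \<in> \<Y>" "Y' \<in> \<Y>" "Y \<inter> s = Y' \<inter> s" for Y Y'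
  proof (rule ccontr)
    assume "Y \<noteq> Y'"
    then have "d (Y, Y') \<in> s" using that unfolding s_def by auto
    then show False using d[OF \<open>Y \<noteq> Y'\<close>] that(3) by blast
  qed
  have "Y \<inter> s \<in> ?A \<longleftrightarrow> Y \<in> \<S>" if "Y \<in> \<Y>" for Y
    using inj that by blast
  ultimately show ?thesis
    using s by (intro bexI[of _ "(s, ?A)"]) auto
qed

text \<open>The intersection, over \<open>Y \<in> \<Y>\<close>, of the Hausdorff set of
  \<open>Y\<close> or its complement, as \<open>\<S>\<close> prescribes. \<open>None\<close> passes
  every condition.\<close>

definition code_set :: "'k set set \<Rightarrow> 'k set set \<Rightarrow> ('k set \<times> 'k set set) option set" where
  "code_set \<Y> \<S> = {q. \<forall>j. q = Some j \<longrightarrow> (\<forall>Y\<in>\<Y>. Y \<inter> fst j \<in> snd j \<longleftrightarrow> Y \<in> \<S>)}"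

text \<open>Generated by the tails, by the requirements that the first coordinate avoid a given
  value, and by the Hausdorff conditions that \<open>\<S>\<close> prescribes. The formula spells out
  finite intersections of these.\<close>

definition code_filter ::
  "'k rel \<Rightarrow> ('k \<Rightarrow> 'l \<times> ('k set \<times> 'k set set) option) \<Rightarrow> 'k set set \<Rightarrow> 'k filter" where
  "code_filter r p \<S> = Abs_filter (\<lambda>P. \<exists>\<beta> s \<Y>. \<beta> \<in> Field r \<and> finite s \<and> finite \<Y> \<and> \<Y> \<subseteq> Pow (Field r)
     \<and> (\<forall>\<alpha>. (\<beta>, \<alpha>) \<in> r \<longrightarrow> fst (p \<alpha>) \<notin> s \<longrightarrow> snd (p \<alpha>) \<in> code_set \<Y> \<S> \<longrightarrow> P \<alpha>))"

text \<open>Two base sets contain a third: take an upper bound of the two \<beta> and the unions of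
  the finite sets.\<close>

lemma eventually_code_filter:
  assumes r: "Cinfinite r"
  shows "eventually P (code_filter r p \<S>) \<longleftrightarrow>
    (\<exists>\<beta> s \<Y>. \<beta> \<in> Field r \<and> finite s \<and> finite \<Y> \<and> \<Y> \<subseteq> Pow (Field r)
     \<and> (\<forall>\<alpha>. (\<beta>, \<alpha>) \<in> r \<longrightarrow> fst (p \<alpha>) \<notin> s \<longrightarrow> snd (p \<alpha>) \<in> code_set \<Y> \<S> \<longrightarrow> P \<alpha>))"
    (is "_ \<longleftrightarrow> ?ev P")
  unfolding code_filter_def
proof (rule eventually_Abs_filter, unfold_locales)
  show "?ev (\<lambda>\<alpha>. True)"
    using Cinfinite_Field_nonempty[OF r] by blast
next
  fix P Q
  assume "?ev P" "?ev Q"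
  then obtain \<beta> s \<Y> \<beta>' s' \<Y>' where
    P: "\<beta> \<in> Field r" "finite s" "finite \<Y>" "\<Y> \<subseteq> Pow (Field r)"
    "\<And>\<alpha>. (\<beta>, \<alpha>) \<in> r \<Longrightarrow> fst (p \<alpha>) \<notin> s \<Longrightarrow> snd (p \<alpha>) \<in> code_set \<Y> \<S> \<Longrightarrow> P \<alpha>" and
    Q: "\<beta>' \<in> Field r" "finite s'" "finite \<Y>'" "\<Y>' \<subseteq> Pow (Field r)"
    "\<And>\<alpha>. (\<beta>', \<alpha>) \<in> r \<Longrightarrow> fst (p \<alpha>) \<notin> s' \<Longrightarrow> snd (p \<alpha>) \<in> code_set \<Y>' \<S> \<Longrightarrow> Q \<alpha>"
    by (elim exE conjE) metis
  obtain \<gamma> where \<gamma>: "\<gamma> \<in> Field r" "(\<beta>, \<gamma>) \<in> r" "(\<beta>', \<gamma>) \<in> r"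
    using Cinfinite_upper_bound[OF r P(1) Q(1)] by blast
  have "code_set (\<Y> \<union> \<Y>') \<S> \<subseteq> code_set \<Y> \<S> \<inter> code_set \<Y>' \<S>"
    unfolding code_set_def by blast
  then have "P \<alpha> \<and> Q \<alpha>"
    if "(\<gamma>, \<alpha>) \<in> r" "fst (p \<alpha>) \<notin> s \<union> s'" "snd (p \<alpha>) \<in> code_set (\<Y> \<union> \<Y>') \<S>" for \<alpha>
    using that P(5) Q(5) Cinfinite_trans[OF r] \<gamma> by blast
  with P Q \<gamma>(1) show "?ev (\<lambda>\<alpha>. P \<alpha> \<and> Q \<alpha>)"
    by (intro exI[of _ \<gamma>] exI[of _ "s \<union> s'"] exI[of _ "\<Y> \<union> \<Y>'"]) auto
next
  fix P Q :: "'a \<Rightarrow> bool"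
  assume "\<forall>\<alpha>. P \<alpha> \<longrightarrow> Q \<alpha>" and "?ev P"
  then show "?ev Q"
    by meson
qed

lemma eventually_code_filter_tail:
  assumes "Cinfinite r" "\<beta> \<in> Field r"
  shows "\<forall>\<^sub>F \<alpha> in code_filter r p \<S>. (\<beta>, \<alpha>) \<in> r"
  unfolding eventually_code_filter[OF assms(1)] using assms(2)
  by (intro exI[of _ \<beta>] exI[of _ "{}"]) auto

lemma eventually_code_filter_fst:
  assumes "Cinfinite r"
  shows "\<forall>\<^sub>F \<alpha> in code_filter r p \<S>. fst (p \<alpha>) \<noteq> \<xi>"
proof -
  obtain \<beta> where "\<beta> \<in> Field r" using Cinfinite_Field_nonempty[OF assms] by blast
  then show ?thesis
    unfolding eventually_code_filter[OF assms]
    by (intro exI[of _ \<beta>] exI[of _ "{\<xi>}"] exI[of _ "{}"]) auto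
qed

lemma eventually_code_filter_snd:
  assumes "Cinfinite r" "Y \<subseteq> Field r"
  shows "\<forall>\<^sub>F \<alpha> in code_filter r p \<S>. snd (p \<alpha>) \<in> code_set {Y} \<S>"
proof -
  obtain \<beta> where "\<beta> \<in> Field r" using Cinfinite_Field_nonempty[OF assms(1)] by blast
  then show ?thesis
    unfolding eventually_code_filter[OF assms(1)] using assms(2)
    by (intro exI[of _ \<beta>] exI[of _ "{}"] exI[of _ "{Y}"]) auto
qed

text \<open>The codes \<open>j = (s, \<A>)\<close> with \<open>Y \<inter> s \<in> \<A>\<close> form Hausdorff's independent family indexed by the
  subsets \<open>Y\<close>. The extra code \<open>None\<close> belongs to every set of the filter, so that only the first
  component of \<open>p\<close> decides how many sets of the filter are needed for an empty intersection.\<close>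

locale coding =
  fixes r :: "'k rel" and \<mu> :: "'l rel" and p :: "'k \<Rightarrow> 'l \<times> ('k set \<times> 'k set set) option"
  assumes r: "Cinfinite r" and \<mu>: "Cinfinite \<mu>" "\<mu> \<le>o cf r"
    and range: "p ` Field r \<subseteq> Field \<mu> \<times> UNIV"
    and fiber: "\<lbrakk>\<xi> \<in> Field \<mu>; q \<in> insert None (Some ` (Fpow (Field r) \<times> Fpow (Fpow (Field r)))); \<beta> \<in> Field r\<rbrakk>
      \<Longrightarrow> \<exists>\<alpha>\<in>Field r. (\<beta>, \<alpha>) \<in> r \<and> p \<alpha> = (\<xi>, q)"
begin

text \<open>Fewer than \<open>cf r\<close> tails have a common bound \<open>b\<close>, and fewer
  than \<mu> finite sets leave some \<xi> uncovered. An index beyond \<open>b\<close> with value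
  \<open>(\<xi>, None)\<close> is in every set.\<close>

lemma code_filter_Inter_nonempty:
  assumes small: "|\<A>| <o \<mu>" and ev: "\<And>A. A \<in> \<A> \<Longrightarrow> \<forall>\<^sub>F \<alpha> in code_filter r p \<S>. \<alpha> \<in> A"
  shows "\<Inter>\<A> \<noteq> {}"
proof -
  \<comment> \<open>Looking only at indices with code \<open>None\<close> makes the Hausdorff
    conditions disappear.\<close>
  have "\<exists>\<beta> s. \<beta> \<in> Field r \<and> finite s \<and> (\<forall>\<alpha>. (\<beta>, \<alpha>) \<in> r \<longrightarrow> fst (p \<alpha>) \<notin> s \<longrightarrow> snd (p \<alpha>) = None \<longrightarrow> \<alpha> \<in> A)"
    if A: "A \<in> \<A>" for A
  proof -
    obtain \<beta> s \<Y> where "\<beta> \<in> Field r" "finite s"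
      "\<forall>\<alpha>. (\<beta>, \<alpha>) \<in> r \<longrightarrow> fst (p \<alpha>) \<notin> s \<longrightarrow> snd (p \<alpha>) \<in> code_set \<Y> \<S> \<longrightarrow> \<alpha> \<in> A"
      using ev[OF A] unfolding eventually_code_filter[OF r] by (elim exE conjE) (rule that)
    moreover have "None \<in> code_set \<Y> \<S>" unfolding code_set_def by simp
    ultimately show ?thesis by metis
  qed
  then obtain \<beta> s where \<beta>: "\<And>A. A \<in> \<A> \<Longrightarrow> \<beta> A \<in> Field r" and s: "\<And>A. A \<in> \<A> \<Longrightarrow> finite (s A)"
    and A: "\<And>A \<alpha>. \<lbrakk>A \<in> \<A>; (\<beta> A, \<alpha>) \<in> r; fst (p \<alpha>) \<notin> s A; snd (p \<alpha>) = None\<rbrakk> \<Longrightarrow> \<alpha> \<in> A"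
    by metis
  have "\<beta> ` \<A> \<subseteq> Field r"
    using \<beta> by blast
  moreover have "|\<beta> ` \<A>| <o cf r"
    using image_ordLess[OF small] \<mu>(2) by (rule ordLess_ordLeq_trans)
  ultimately obtain b where b: "b \<in> Field r" "\<And>a. a \<in> \<beta> ` \<A> \<Longrightarrow> (a, b) \<in> r"
    using bounded_if_ordLess_cf[OF r] by metis
  have "|\<Union>A\<in>\<A>. s A| <o \<mu>"
    by (rule UN_finite_ordLess_Cinfinite[OF \<mu>(1) small s])
  then have "\<not> Field \<mu> \<subseteq> (\<Union>A\<in>\<A>. s A)"
    using card_of_Field_ordIso[of \<mu>] \<mu>(1) card_of_mono1[of "Field \<mu>"] not_ordLess_ordIso
      ordLeq_ordLess_trans by metis
  then obtain \<xi> where \<xi>: "\<xi> \<in> Field \<mu>" "\<forall>A\<in>\<A>. \<xi> \<notin> s A" by blast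
  obtain \<alpha> where "(b, \<alpha>) \<in> r" "p \<alpha> = (\<xi>, None)"
    using fiber[OF \<xi>(1) _ b(1)] by blast
  then have "\<alpha> \<in> \<Inter>\<A>"
    using A Cinfinite_trans[OF r b(2)] \<xi>(2) by simp
  then show ?thesis by blast
qed

text \<open>By independence some code obeys \<open>\<S>'\<close> on \<open>\<Y>\<close> and on
  \<open>Y\<close> at once. An index with this code, far out and with first coordinate outside
  \<open>s\<close>, lies in the base set but violates what \<open>\<S>\<close> demands at
  \<open>Y\<close>.\<close>

lemma not_eventually_code_filter:
  assumes "Y \<subseteq> Field r" "Y \<in> \<S>" "Y \<notin> \<S>'"
  shows "\<not> (\<forall>\<^sub>F \<alpha> in code_filter r p \<S>'. snd (p \<alpha>) \<in> code_set {Y} \<S>)"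
proof
  assume "\<forall>\<^sub>F \<alpha> in code_filter r p \<S>'. snd (p \<alpha>) \<in> code_set {Y} \<S>"
  then obtain \<beta> s \<Y> where \<beta>: "\<beta> \<in> Field r" and s: "finite s" and \<Y>: "finite \<Y>" "\<Y> \<subseteq> Pow (Field r)"
    and imp: "\<forall>\<alpha>. (\<beta>, \<alpha>) \<in> r \<longrightarrow> fst (p \<alpha>) \<notin> s \<longrightarrow> snd (p \<alpha>) \<in> code_set \<Y> \<S>'
      \<longrightarrow> snd (p \<alpha>) \<in> code_set {Y} \<S>"
    unfolding eventually_code_filter[OF r] by (elim exE conjE) (rule that)
  obtain j where j: "j \<in> Fpow (Field r) \<times> Fpow (Fpow (Field r))"
    "\<forall>Z\<in>insert Y \<Y>. Z \<inter> fst j \<in> snd j \<longleftrightarrow> Z \<in> \<S>'"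
    using exists_code[of "insert Y \<Y>" "Field r" \<S>'] \<Y> assms(1) by auto
  obtain \<xi> where \<xi>: "\<xi> \<in> Field \<mu>" "\<xi> \<notin> s"
    using s \<mu>(1) unfolding cinfinite_def by (meson finite_subset subsetI)
  obtain \<alpha> where "(\<beta>, \<alpha>) \<in> r" "p \<alpha> = (\<xi>, Some j)"
    using fiber[OF \<xi>(1) _ \<beta>] j(1) by blast
  then show False
    using imp[rule_format, of \<alpha>] \<xi>(2) j(2) assms unfolding code_set_def by (cases j) auto
qed

end

text \<open>Finite subsets do not increase an infinite cardinality, and \<mu> is at most
  \<open>r\<close> through its cofinality, so there are at most \<open>r\<close> pairs to be hit
  cofinally.\<close>

lemma exists_coding:
  fixes r :: "'k rel" and \<mu> :: "'l rel"
  assumes r: "Cinfinite r" and \<mu>: "Cinfinite \<mu>" "\<mu> \<le>o cf r"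
  shows "\<exists>p. coding r \<mu> p"
proof -
  let ?I = "Field r"
  let ?J = "Fpow ?I \<times> Fpow (Fpow ?I)"
  let ?B = "Field \<mu> \<times> insert None (Some ` ?J)"
  have I: "|?I| =o r" "infinite ?I"
    using r card_of_Field_ordIso unfolding cinfinite_def by auto
  have Fp: "|Fpow ?I| =o |?I|"
    using I by simp
  then have "infinite (Fpow ?I)"
    using I card_of_ordIso_finite by blast
  then have Fpp: "|Fpow (Fpow ?I)| \<le>o |?I|"
    using Fp card_of_Fpow_infinite ordIso_transitive ordIso_imp_ordLeq by blast
  have "|?J| \<le>o |?I|"
    by (rule card_of_Times_ordLeq_infinite[OF I(2) ordIso_imp_ordLeq[OF Fp] Fpp])
  then have "|Some ` ?J| \<le>o |?I|"
    using card_of_image ordLeq_transitive by blast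
  moreover have "|{None :: ('k set \<times> 'k set set) option}| \<le>o |?I|"
    using I(2) by (intro ordLess_imp_ordLeq finite_ordLess_infinite2) simp_all
  ultimately have "|{None} \<union> Some ` ?J| \<le>o |?I|"
    by (intro card_of_Un_ordLeq_infinite I(2))
  moreover have "|Field \<mu>| \<le>o |?I|"
    using card_of_Field_ordIso[of \<mu>] \<mu> cf_ordLeq[OF r] I(1) ordIso_symmetric
      ordIso_ordLeq_trans ordLeq_ordIso_trans ordLeq_transitive by blast
  ultimately have "|?B| \<le>o |?I|"
    using card_of_Times_ordLeq_infinite[OF I(2), of "Field \<mu>"] by simp
  then have B: "|?B| \<le>o r"
    using I(1) by (rule ordLeq_ordIso_trans)
  have "?B \<noteq> {}"
    using Cinfinite_Field_nonempty[OF \<mu>(1)] by blast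
  from exists_cofinal_fibers[OF r B this] obtain p where p: "p ` ?I = ?B"
    "\<And>b \<beta>. b \<in> ?B \<Longrightarrow> \<beta> \<in> ?I \<Longrightarrow> \<exists>\<alpha>\<in>?I. (\<beta>, \<alpha>) \<in> r \<and> p \<alpha> = b"
    by metis
  have "coding r \<mu> p"
  proof
    show "p ` ?I \<subseteq> Field \<mu> \<times> UNIV"
      unfolding p(1) by blast
    fix \<xi> q \<beta> assume "\<xi> \<in> Field \<mu>" "q \<in> insert None (Some ` ?J)" "\<beta> \<in> ?I"
    then show "\<exists>\<alpha>\<in>?I. (\<beta>, \<alpha>) \<in> r \<and> p \<alpha> = (\<xi>, q)"
      using p(2)[OF SigmaI] by simp
  qed (fact r \<mu>)+
  then show ?thesis by blast
qed

section \<open>One topology for each family of subsets of \<kappa>\<close>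

theorem theorem5p1:
  fixes G :: "('g, 'm) monoid_scheme" and X :: "'x set" and act :: "'g \<Rightarrow> 'x \<Rightarrow> 'x" and x0 :: 'x
    and \<kappa> :: "'k rel" and \<mu> :: "'l rel"
  assumes "monoid_act G X act"
    and "x0 \<in> X"
    and "|carrier G| \<le>o pseudocharacter (zariski_topology G X act) x0"
    and "Cinfinite \<kappa>"
    and "|carrier G| \<le>o \<kappa>"
    and "\<kappa> \<le>o pseudocharacter (zariski_topology G X act) x0"
    and "Cinfinite \<mu>"
    and "\<mu> \<le>o cf \<kappa>"
  shows "\<exists>\<T> :: 'x topology set.
    |\<T>| =o ctwo ^c (ctwo ^c \<kappa>) \<and>
    (\<forall>\<tau>\<in>\<T>. act_topology G X act \<tau> \<and> hereditarily_normal \<tau> \<and> pseudocharacter \<tau> x0 =o \<mu>)"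
proof -
  obtain H x where "generic_sequence G X act x0 \<kappa> H x"
    using monoid_act.exists_generic_sequence[OF assms(1,2,4,6,5)] by (elim exE)
  then interpret generic_sequence G X act x0 \<kappa> H x .
  obtain p where "coding \<kappa> \<mu> p"
    using exists_coding[OF assms(4,7,8)] ..
  then interpret coding \<kappa> \<mu> p .
  let ?F = "code_filter \<kappa> p"
  let ?S = "Pow (Pow (Field \<kappa>))"
  have tail: "tail_filter G X act x0 \<kappa> H x (?F \<S>)" for \<S>
    by unfold_locales (rule eventually_code_filter_tail[OF assms(4)])
  \<comment> \<open>The Hausdorff condition at \<open>Y \<in> \<S>\<close> belongs to the first
    filter, hence to the second because the topologies agree; this forces
    \<open>Y \<in> \<S>'\<close>.\<close>
  have sub: "\<S> \<subseteq> \<S>'" if "\<S> \<in> ?S" "filter_topology (?F \<S>) = filter_topology (?F \<S>')" for \<S> \<S>'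
  proof
    fix Y assume Y: "Y \<in> \<S>"
    then have "Y \<subseteq> Field \<kappa>" using that by blast
    from eventually_code_filter_snd[OF assms(4) this, of p \<S>]
    have "\<forall>\<^sub>F \<alpha> in ?F \<S>'. \<alpha> \<in> {\<alpha>. snd (p \<alpha>) \<in> code_set {Y} \<S>}"
      by (intro filter_topology_le[OF tail tail that(2)]) simp
    then show "Y \<in> \<S>'"
      using not_eventually_code_filter[OF \<open>Y \<subseteq> Field \<kappa>\<close> Y] by auto
  qed
  have "inj_on (\<lambda>\<S>. filter_topology (?F \<S>)) ?S"
    by (intro inj_onI subset_antisym sub) auto
  then have "|(\<lambda>\<S>. filter_topology (?F \<S>)) ` ?S| =o |?S|"
    by (meson card_of_ordIsoI inj_on_imp_bij_betw ordIso_symmetric)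
  then have card: "|(\<lambda>\<S>. filter_topology (?F \<S>)) ` ?S| =o ctwo ^c (ctwo ^c \<kappa>)"
    using Pow_Pow_Field_ordIso assms(4) ordIso_transitive by blast
  have psi: "pseudocharacter (filter_topology (?F \<S>)) x0 =o \<mu>" for \<S>
  proof -
    interpret tail_filter G X act x0 \<kappa> H x "?F \<S>" by (rule tail)
    have "pseudocharacter (filter_topology (?F \<S>)) x0 \<le>o |Field \<mu>|"
    \<comment> \<open>Each index in \<open>Field \<kappa>\<close> is excluded by the set belonging
      to its own first coordinate, so these sets, indexed by \<open>Field \<mu>\<close>, have no
      common index there.\<close>
    proof (rule pseudocharacter_ordLeq[where A = "\<lambda>\<xi>. {\<alpha>. fst (p \<alpha>) \<noteq> \<xi>}"])
      show "\<exists>\<xi>\<in>Field \<mu>. \<alpha> \<notin> {\<alpha>. fst (p \<alpha>) \<noteq> \<xi>}" if "\<alpha> \<in> Field \<kappa>" for \<alpha>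
        using range that by force
    qed (use eventually_code_filter_fst[OF assms(4)] in simp)
    then have "pseudocharacter (filter_topology (?F \<S>)) x0 \<le>o \<mu>"
      using card_of_Field_ordIso assms(7) ordLeq_ordIso_trans by blast
    moreover have "\<mu> \<le>o pseudocharacter (filter_topology (?F \<S>)) x0"
      using ordLeq_pseudocharacter code_filter_Inter_nonempty assms(7) by blast
    ultimately show ?thesis
      by (simp add: ordIso_iff_ordLeq)
  qed
  show ?thesis
  proof (intro exI conjI ballI)
    fix \<tau> assume "\<tau> \<in> (\<lambda>\<S>. filter_topology (?F \<S>)) ` ?S"
    then obtain \<S> where \<tau>: "\<tau> = filter_topology (?F \<S>)" by blast
    show "act_topology G X act \<tau>"
      unfolding \<tau> by (rule act_topology_filter_topology)
    show "hereditarily_normal \<tau>"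
      unfolding \<tau> by (rule tail_filter.hereditarily_normal_filter_topology[OF tail])
    show "pseudocharacter \<tau> x0 =o \<mu>"
      unfolding \<tau> by (rule psi)
  qed (rule card)
qed

end
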